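(* Let $E$ be a finite set with $|E|\ge 2$, let $K\subseteq\mathbb R_+^E$ be a rational polyhedral cone, let $P=K\cap[0,1]^E$, let $c\in\mathbb R^E$ and assume $\alpha:=\max\{c^\top y:y\in P\}>0$. Then $$\mathfrak O\subseteq\mathcal B_\infty\subseteq\mathcal B_1=\mathfrak F .$$ Consequently, $\mathcal D_1$ is the family of inclusion-minimal supports of feasible upper-bound multiplier vectors, i.e. the inclusion-minimal members of $\{\operatorname{supp}(u):u\in\mathbb R^E,\ u\ge0,\ u-c\in K^*\}$.
   Context: For $y\in\mathbb R_+^E$, $\operatorname{supp}(y)=\{e\in E:y_e>0\}$. $K^*=\{s\in\mathbb R^E:s^\top x\ge0\ \forall x\in K\}$ is the dual cone. For an integer $\ell\ge1$, $\mathcal B_\ell$ is the family of sets $J\subseteq E$ such that for all $z^1,\dots,z^\ell\in P$: $\left(\bigcap_{i=1}^\ell\operatorname{supp}(z^i)\right)\cap J=\emptyset$ implies $\sum_{i=1}^\ell c^\top z^i\le\alpha(\ell-1)$. $\mathcal B_\infty=\bigcap_{\ell\ge1}\mathcal B_\ell$. $\mathcal D_\ell$ is the family of inclusion-minimal members of $\mathcal B_\ell$. $\mathfrak F=\{J\subseteq E:\exists u\ge0,\ \operatorname{supp}(u)\subseteq J,\ u-c\in K^*\}$ and $\mathfrak O=\{J\subseteq E:\exists u\ge0,\ \operatorname{supp}(u)\subseteq J,\ u-c\in K^*,\ \mathbf 1^\top u=\alpha\}$. (By LP duality $\alpha=\min\{\mathbf1^\top u:u\ge0,\ u-c\in K^*\}$;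 vectors $u$ feasible for this problem are the feasible upper-bound multiplier vectors.) *)

theory Defs
  imports "HOL-Analysis.Analysis"
begin

text \<open>
  The finite ground set \<open>E\<close> is the universe of a type \<open>'e\<close> of class \<open>finite\<close>, and
  \<open>\<real>\<^sup>E\<close> is \<open>real^'e\<close>.  The order on it is the componentwise one of
  the library, so that \<open>0 \<le> u\<close> says that all entries of \<open>u\<close> are nonnegative and
  \<open>{0..1}\<close> is the unit cube.
\<close>

definition supp :: "(real^'e::finite) \<Rightarrow> 'e set" where
  "supp y = {e. y $ e > 0}"

text \<open>A cone \<open>{x. A x \<ge> 0}\<close> for a rational matrix \<open>A\<close>, given by the finite set of its rows.\<close>

definition rational_polyhedral_cone :: "(real^'e::finite) set \<Rightarrow> bool" where
  "rational_polyhedral_cone K \<longleftrightarrow>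
     (\<exists>A. finite A \<and> (\<forall>a\<in>A. \<forall>e. a $ e \<in> \<rat>) \<and> K = {x. \<forall>a\<in>A. a \<bullet> x \<ge> 0})"

definition dual_cone :: "(real^'e::finite) set \<Rightarrow> (real^'e) set" where
  "dual_cone K = {s. \<forall>x\<in>K. s \<bullet> x \<ge> 0}"

definition box_part :: "(real^'e::finite) set \<Rightarrow> (real^'e) set" where
  "box_part K = K \<inter> {0..1}"

text \<open>The number \<open>\<alpha>\<close>, as the greatest element of the set of objective values.  The lemma
  \<open>opt_value_is_max\<close> shows that the maximum is attained.\<close>

definition opt_value :: "(real^'e::finite) set \<Rightarrow> (real^'e) \<Rightarrow> real" where
  "opt_value K c = (GREATEST v. v \<in> (\<lambda>y. c \<bullet> y) ` box_part K)"

lemma opt_value_is_max: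
  fixes K :: "(real^'e::finite) set"
  assumes "rational_polyhedral_cone K"
  shows "opt_value K c \<in> (\<lambda>y. c \<bullet> y) ` box_part K"
    and "\<And>y. y \<in> box_part K \<Longrightarrow> c \<bullet> y \<le> opt_value K c"
proof -
  obtain A where K: "K = {x. \<forall>a\<in>A. a \<bullet> x \<ge> 0}"
    using assms unfolding rational_polyhedral_cone_def by blast
  have "K = (\<Inter>a\<in>A. {x. a \<bullet> x \<ge> 0})"
    by (auto simp: K)
  then have "closed K"
    by (auto intro!: closed_INT closed_halfspace_ge)
  moreover have cube: "{0..1} = (cbox 0 1 :: (real^'e) set)"
    by (auto simp: less_eq_vec_def mem_box_cart)
  ultimately have "compact (box_part K)"
    unfolding box_part_def cube by (intro closed_Int_compact compact_cbox)
  moreover have "0 \<in> box_part K"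
    by (auto simp: box_part_def K less_eq_vec_def)
  ultimately obtain y where y: "y \<in> box_part K" "\<forall>x\<in>box_part K. c \<bullet> x \<le> c \<bullet> y"
    using continuous_attains_sup[of "box_part K" "\<lambda>y. c \<bullet> y"]
      continuous_on_inner[OF continuous_on_const continuous_on_id]
    by (metis (no_types, lifting) empty_iff)
  then have "opt_value K c = c \<bullet> y"
    unfolding opt_value_def by (intro Greatest_equality) auto
  with y show "opt_value K c \<in> (\<lambda>y. c \<bullet> y) ` box_part K"
    and "\<And>y. y \<in> box_part K \<Longrightarrow> c \<bullet> y \<le> opt_value K c"
    by auto
qed

definition B_fam :: "(real^'e::finite) set \<Rightarrow> (real^'e) \<Rightarrow> nat \<Rightarrow> 'e set set" where
  "B_fam K c l =
     {J. \<forall>z :: nat \<Rightarrow> (real^'e). (\<forall>i\<in>{1..l}. z i \<in> box_part K) \<longrightarrow>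
           (\<Inter>i\<in>{1..l}. supp (z i)) \<inter> J = {} \<longrightarrow>
           (\<Sum>i=1..l. c \<bullet> z i) \<le> opt_value K c * (real l - 1)}"

definition B_inf :: "(real^'e::finite) set \<Rightarrow> (real^'e) \<Rightarrow> 'e set set" where
  "B_inf K c = (\<Inter>l\<in>{1..}. B_fam K c l)"

definition inclusion_minimal :: "'a set set \<Rightarrow> 'a set set" where
  "inclusion_minimal \<F> = {J \<in> \<F>. \<not> (\<exists>J'\<in>\<F>. J' \<subset> J)}"

definition D_fam :: "(real^'e::finite) set \<Rightarrow> (real^'e) \<Rightarrow> nat \<Rightarrow> 'e set set" where
  "D_fam K c l = inclusion_minimal (B_fam K c l)"

definition F_fam :: "(real^'e::finite) set \<Rightarrow> (real^'e) \<Rightarrow> 'e set set" where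
  "F_fam K c = {J. \<exists>u. 0 \<le> u \<and> supp u \<subseteq> J \<and> u - c \<in> dual_cone K}"

definition O_fam :: "(real^'e::finite) set \<Rightarrow> (real^'e) \<Rightarrow> 'e set set" where
  "O_fam K c = {J. \<exists>u. 0 \<le> u \<and> supp u \<subseteq> J \<and> u - c \<in> dual_cone K \<and>
                       (\<Sum>e\<in>UNIV. u $ e) = opt_value K c}"

end

theory Submission
  imports Defs
begin

text \<open>
  For the first inclusion, a multiplier \<open>u\<close> of total weight \<open>\<alpha>\<close> bounds \<open>c \<bullet> z\<close> by \<open>u \<bullet> z\<close> on \<open>P\<close>.
  If \<open>z\<^sup>1, \<dots>, z\<^sup>l\<close> have no common support element in \<open>J\<close>, then each coordinate charged by \<open>u\<close>
  vanishes in at least one of the \<open>l\<close> points, so it collects at most \<open>l - 1\<close> in the sum of the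
  points, and the total is at most \<open>\<alpha> (l - 1)\<close>.

  For \<open>l = 1\<close>, membership of \<open>J\<close> says that \<open>c\<close> is nonpositive on the points of \<open>P\<close> that vanish on
  \<open>J\<close>.  A multiplier supported on \<open>J\<close> certifies this.  Conversely, a multiplier can be written
  down explicitly: \<open>P\<close> is a polytope, the convex hull of a finite set \<open>V\<close>, and the vector
  \<open>M \<cdot> 1\<^sub>J\<close> dominates \<open>c\<close> at every \<open>v \<in> V\<close> once \<open>M\<close> is large.  Indeed, where \<open>v\<close> vanishes on \<open>J\<close> the hypothesis gives \<open>c \<bullet> v \<le> 0\<close>, and otherwise \<open>1\<^sub>J \<bullet> v > 0\<close>, with finitely many
  such conditions on \<open>M\<close>.  The domination extends to \<open>P\<close> by convexity and to \<open>K\<close> by scaling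
  (lemma \<open>B_fam_1_subset_F_fam\<close>).

  Finally, \<open>\<FF>\<close> is the upward closure of the set of supports of multipliers, and a family of
  sets has the same minimal members as its upward closure.
\<close>

lemma multiplier_dominates:
  fixes u c x :: "real^'e::finite"
  assumes "u - c \<in> dual_cone K" "x \<in> K"
  shows "c \<bullet> x \<le> u \<bullet> x"
  using assms by (auto simp: dual_cone_def inner_diff_left)

lemma box_part_component:
  assumes "z \<in> box_part K"
  shows "0 \<le> z $ e" "z $ e \<le> 1"
  using assms by (auto simp: box_part_def less_eq_vec_def)

text \<open>
  One of the \<open>l\<close> terms is \<open>0\<close>, since some \<open>z i\<close> vanishes at \<open>e\<close>, and the others are at most \<open>1\<close>.
\<close>
lemma sum_component_le:
  fixes z :: "nat \<Rightarrow> real^'e::finite"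
  assumes z: "\<And>i. i \<in> {1..l} \<Longrightarrow> z i \<in> box_part K"
    and e: "e \<notin> (\<Inter>i\<in>{1..l}. supp (z i))"
  shows "(\<Sum>i=1..l. z i $ e) \<le> real l - 1"
proof -
  obtain k where k: "k \<in> {1..l}" "z k $ e \<le> 0"
    using e by (auto simp: supp_def not_less)
  have "(\<Sum>i=1..l. z i $ e) = z k $ e + (\<Sum>i\<in>{1..l} - {k}. z i $ e)"
    using k by (subst sum.remove[of _ k]) auto
  also have "\<dots> \<le> 0 + (\<Sum>i\<in>{1..l} - {k}. 1)"
    using k z by (intro add_mono sum_mono) (auto intro: box_part_component)
  also have "\<dots> = real l - 1"
    using k by (simp add: of_nat_diff)
  finally show ?thesis .
qed

lemma O_fam_subset_B_fam: "O_fam K c \<subseteq> B_fam K c l"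
proof
  fix J assume "J \<in> O_fam K c"
  then obtain u where u: "0 \<le> u" "supp u \<subseteq> J" "u - c \<in> dual_cone K"
    and sum_u: "(\<Sum>e\<in>UNIV. u $ e) = opt_value K c"
    by (auto simp: O_fam_def)
  show "J \<in> B_fam K c l"
    unfolding B_fam_def
  proof (intro CollectI allI impI)
    fix z assume z: "\<forall>i\<in>{1..l}. z i \<in> box_part K"
      and disj: "(\<Inter>i\<in>{1..l}. supp (z i)) \<inter> J = {}"
    have "(\<Sum>i=1..l. c \<bullet> z i) \<le> (\<Sum>i=1..l. u \<bullet> z i)"
      using z u by (intro sum_mono multiplier_dominates[of _ _ K]) (auto simp: box_part_def)
    also have "\<dots> = (\<Sum>e\<in>UNIV. u $ e * (\<Sum>i=1..l. z i $ e))"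
      by (simp add: inner_vec_def sum_distrib_left) (rule sum.swap)
    also have "\<dots> \<le> (\<Sum>e\<in>UNIV. u $ e * (real l - 1))"
    proof (intro sum_mono)
      fix e
      show "u $ e * (\<Sum>i=1..l. z i $ e) \<le> u $ e * (real l - 1)"
      proof (cases "u $ e = 0")
        case False
        then have "u $ e > 0"
          using u(1) by (auto simp: less_eq_vec_def order_less_le)
        then have "e \<notin> (\<Inter>i\<in>{1..l}. supp (z i))"
          using u(2) disj by (auto simp: supp_def)
        then have "(\<Sum>i=1..l. z i $ e) \<le> real l - 1"
          using z by (intro sum_component_le[of _ _ K]) auto
        then show ?thesis
          using \<open>u $ e > 0\<close> by (intro mult_left_mono) auto
      qed simp
    qed
    also have "\<dots> = opt_value K c * (real l - 1)"
      by (simp add: sum_u flip: sum_distrib_right)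
    finally show "(\<Sum>i=1..l. c \<bullet> z i) \<le> opt_value K c * (real l - 1)" .
  qed
qed

lemma B_fam_1_iff:
  "J \<in> B_fam K c 1 \<longleftrightarrow> (\<forall>z\<in>box_part K. supp z \<inter> J = {} \<longrightarrow> c \<bullet> z \<le> 0)"
proof
  assume J: "J \<in> B_fam K c 1"
  show "\<forall>z\<in>box_part K. supp z \<inter> J = {} \<longrightarrow> c \<bullet> z \<le> 0"
  proof (intro ballI impI)
    fix z assume "z \<in> box_part K" "supp z \<inter> J = {}"
    with J show "c \<bullet> z \<le> 0"
      by (auto simp: B_fam_def dest: spec[of _ "\<lambda>_. z"])
  qed
qed (auto simp: B_fam_def)

lemma F_fam_subset_B_fam_1: "F_fam K c \<subseteq> B_fam K c 1"
proof
  fix J assume "J \<in> F_fam K c"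
  then obtain u where u: "0 \<le> u" "supp u \<subseteq> J" "u - c \<in> dual_cone K"
    by (auto simp: F_fam_def)
  have "c \<bullet> z \<le> 0" if z: "z \<in> box_part K" "supp z \<inter> J = {}" for z
  proof -
    have "u $ e * z $ e \<le> 0" for e
      using u z(2) box_part_component(1)[OF z(1), of e]
      by (cases "u $ e = 0"; cases "z $ e = 0") (auto simp: supp_def less_eq_vec_def order_less_le)
    then have "u \<bullet> z \<le> 0"
      by (auto simp: inner_vec_def intro: sum_nonpos)
    moreover have "c \<bullet> z \<le> u \<bullet> z"
      using u z by (intro multiplier_dominates[of _ _ K]) (auto simp: box_part_def)
    ultimately show ?thesis
      by simp
  qed
  then show "J \<in> B_fam K c 1"
    unfolding B_fam_1_iff by blast
qed

lemma polytope_box_part: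
  fixes K :: "(real^'e::finite) set"
  assumes "rational_polyhedral_cone K"
  shows "polytope (box_part K)"
proof -
  obtain A where A: "finite A" and K: "K = {x. \<forall>a\<in>A. a \<bullet> x \<ge> 0}"
    using assms unfolding rational_polyhedral_cone_def by blast
  have "K = \<Inter>((\<lambda>a. {x. a \<bullet> x \<ge> 0}) ` A)"
    by (auto simp: K)
  then have "polyhedron K"
    using A by (auto intro!: polyhedron_Inter polyhedron_halfspace_ge)
  moreover have "{0..1} = (cbox 0 1 :: (real^'e) set)"
    by (auto simp: less_eq_vec_def mem_box_cart)
  ultimately show ?thesis
    unfolding box_part_def
    by (simp add: polyhedron_Int_polytope polytope_interval)
qed

text \<open>
  Dividing by \<open>norm x + 1\<close>, an upper bound for all entries that is positive also when \<open>x = 0\<close>,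
  moves a point of the cone into the cube.
\<close>
lemma scale_into_box_part:
  fixes K :: "(real^'e::finite) set"
  assumes "rational_polyhedral_cone K" "K \<subseteq> {x. 0 \<le> x}" "x \<in> K"
  obtains t y where "t > 0" "y \<in> box_part K" "x = t *\<^sub>R y"
proof -
  define t where "t = norm x + 1"
  have t: "t > 0"
    by (simp add: t_def add_nonneg_pos)
  have "inverse t *\<^sub>R x \<in> K"
    using assms(1,3) t by (auto simp: rational_polyhedral_cone_def)
  moreover have "x $ e \<le> t" for e
    using component_le_norm_cart[of x e] by (simp add: t_def)
  ultimately have "inverse t *\<^sub>R x \<in> box_part K"
    using assms(2,3) t by (auto simp: box_part_def less_eq_vec_def field_simps)
  then show thesis
    using t by (intro that[of t "inverse t *\<^sub>R x"]) auto
qed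

text \<open>
  Where \<open>w\<close> vanishes, \<open>c\<close> is already nonpositive; each other \<open>v\<close> asks for \<open>M\<close> to be at least the
  ratio \<open>c \<bullet> v / w \<bullet> v\<close>, and \<open>V\<close> is finite.  Below, \<open>V\<close> spans the polytope \<open>P\<close> and \<open>w\<close> is the
  indicator vector of \<open>J\<close>.
\<close>
lemma finite_multiple_dominates:
  fixes c w :: "'a::real_inner"
  assumes "finite V" and "\<And>v. v \<in> V \<Longrightarrow> w \<bullet> v \<ge> 0"
    and "\<And>v. v \<in> V \<Longrightarrow> w \<bullet> v = 0 \<Longrightarrow> c \<bullet> v \<le> 0"
  obtains M where "M \<ge> 0" "\<And>v. v \<in> V \<Longrightarrow> c \<bullet> v \<le> (M *\<^sub>R w) \<bullet> v"
proof
  \<comment> \<open>The sum bounds each of its terms; where \<open>w \<bullet> v = 0\<close> the quotient is \<open>0\<close> and does no harm.\<close>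
  define M where "M = (\<Sum>v\<in>V. \<bar>c \<bullet> v\<bar> / (w \<bullet> v))"
  show "M \<ge> 0"
    unfolding M_def using assms(2) by (intro sum_nonneg) auto
  show "c \<bullet> v \<le> (M *\<^sub>R w) \<bullet> v" if v: "v \<in> V" for v
  proof (cases "w \<bullet> v = 0")
    case True
    then show ?thesis
      using assms(3)[OF v] by simp
  next
    case False
    then have pos: "w \<bullet> v > 0"
      using assms(2)[OF v] by simp
    have "\<bar>c \<bullet> v\<bar> / (w \<bullet> v) \<le> M"
      unfolding M_def using assms(1,2) v
      by (intro member_le_sum[where f = "\<lambda>v. \<bar>c \<bullet> v\<bar> / (w \<bullet> v)"]) auto
    then show ?thesis
      using pos by (simp add: field_simps)
  qed
qed

text \<open>
  Every element of \<open>K\<close> is a positive multiple of a convex combination of vertices of the polytope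
  \<open>P\<close>, so it suffices that a multiple of the indicator of \<open>J\<close> dominates \<open>c\<close> at these vertices.
\<close>
lemma B_fam_1_subset_F_fam:
  fixes K :: "(real^'e::finite) set"
  assumes K: "rational_polyhedral_cone K" "K \<subseteq> {x. 0 \<le> x}"
  shows "B_fam K c 1 \<subseteq> F_fam K c"
proof
  fix J assume J: "J \<in> B_fam K c 1"
  obtain V where V: "finite V" "box_part K = convex hull V"
    using polytope_box_part[OF K(1)] by (auto simp: polytope_def)
  define w :: "real^'e" where "w = (\<chi> e. if e \<in> J then 1 else 0)"
  have w_inner: "w \<bullet> v = (\<Sum>e\<in>J. v $ e)" for v
    proof -
    have "w \<bullet> v = (\<Sum>e\<in>UNIV. if e \<in> J then v $ e else 0)"
      by (auto simp: w_def inner_vec_def intro: sum.cong)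
    then show ?thesis
      by (simp add: sum.If_cases)
  qed
  have P: "v \<in> box_part K" if "v \<in> V" for v
    using that V(2) by (simp add: hull_inc)
  have "c \<bullet> v \<le> 0" if v: "v \<in> V" "w \<bullet> v = 0" for v
  proof -
    have "\<forall>e\<in>J. v $ e = 0"
      using v(2) box_part_component(1)[OF P[OF v(1)]]
      by (simp add: w_inner sum_nonneg_eq_0_iff)
    then have "supp v \<inter> J = {}"
      by (auto simp: supp_def)
    then show ?thesis
      using J P[OF v(1)] unfolding B_fam_1_iff by blast
  qed
  moreover have "w \<bullet> v \<ge> 0" if "v \<in> V" for v
    using box_part_component(1)[OF P[OF that]] by (simp add: w_inner sum_nonneg)
  ultimately obtain M where M: "M \<ge> 0" "\<And>v. v \<in> V \<Longrightarrow> c \<bullet> v \<le> (M *\<^sub>R w) \<bullet> v"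
    using finite_multiple_dominates[OF V(1)] by metis
  let ?u = "M *\<^sub>R w"
  have "box_part K \<subseteq> {x. (?u - c) \<bullet> x \<ge> 0}"
    unfolding V(2) using M(2)
    by (intro hull_minimal convex_halfspace_ge) (auto simp: inner_diff_left)
  then have "(?u - c) \<bullet> x \<ge> 0" if "x \<in> K" for x
  proof -
    obtain t y where "t > 0" "y \<in> box_part K" "x = t *\<^sub>R y"
      using scale_into_box_part[OF K \<open>x \<in> K\<close>] .
    moreover from this have "(?u - c) \<bullet> y \<ge> 0"
      using \<open>box_part K \<subseteq> _\<close> by blast
    ultimately show ?thesis
      by (simp only: inner_scaleR_right) simp
  qed
  then have "?u - c \<in> dual_cone K"
    by (auto simp: dual_cone_def)
  moreover have "0 \<le> ?u" "supp ?u \<subseteq> J"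
    using M(1) by (auto simp: less_eq_vec_def supp_def w_def split: if_splits)
  ultimately show "J \<in> F_fam K c"
    by (auto simp: F_fam_def)
qed

lemma inclusion_minimal_upward_closure:
  "inclusion_minimal {J. \<exists>S\<in>\<S>. S \<subseteq> J} = inclusion_minimal \<S>"
  unfolding inclusion_minimal_def by blast

theorem theorem3p1:
  fixes K :: "(real^'e::finite) set"
    and c :: "(real^'e)"
  assumes "CARD('e) \<ge> 2"
    and "rational_polyhedral_cone K"
    and "K \<subseteq> {x. 0 \<le> x}"
    and "opt_value K c > 0"
  shows "O_fam K c \<subseteq> B_inf K c \<and> B_inf K c \<subseteq> B_fam K c 1 \<and> B_fam K c 1 = F_fam K c \<and>
         D_fam K c 1 = inclusion_minimal {supp u | u. 0 \<le> u \<and> u - c \<in> dual_cone K}"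
proof -
  have B1: "B_fam K c 1 = F_fam K c"
    using B_fam_1_subset_F_fam[OF assms(2,3)] F_fam_subset_B_fam_1 by blast
  have F: "F_fam K c = {J. \<exists>S\<in>{supp u | u. 0 \<le> u \<and> u - c \<in> dual_cone K}. S \<subseteq> J}"
    by (auto simp: F_fam_def)
  have "D_fam K c 1 = inclusion_minimal {supp u | u. 0 \<le> u \<and> u - c \<in> dual_cone K}"
    unfolding D_fam_def B1 F by (rule inclusion_minimal_upward_closure)
  moreover have "O_fam K c \<subseteq> B_inf K c" "B_inf K c \<subseteq> B_fam K c 1"
    using O_fam_subset_B_fam by (auto simp: B_inf_def)
  ultimately show ?thesis
    using B1 by blast
qed

end
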